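(* The four twisted complexes $(N,b_s)$, $s\in\{S_{18},S_{25},S_{69},S_{74}\}$, defined in the context, represent exactly three homotopy-equivalence classes in $\operatorname{Tw}(\mathcal{B})$. The $S_{18}$ and $S_{25}$ objects are strictly isomorphic. Their common class, the $S_{69}$ class, and the $S_{74}$ class are pairwise distinct.
   Context: **Algebra.** $\mathcal{B}$ is the ungraded associative $\mathbb{F}_2$-algebra (Kotelskiy--Watson--Zibrowius two-arc algebra) with two vertices carrying idempotents $\iota_\circ,\iota_\bullet$, and $\mathbb{F}_2$-basis consisting of the idempotents and the positive words $X^k$, $X\in\{L,M,R\}$, $k\ge1$: $L^k$ are loops at $\circ$, $R^k$ are loops at $\bullet$, and $M$ joins the two vertices in either direction (from each starting vertex one word $M^k$ for each $k\ge1$, ending at the other vertex iff $k$ is odd). Composable words satisfy $X^mX^n=X^{m+n}$; products with different face labels vanish; idempotents are units at their vertices. **Twisted complexes.** An object of $\operatorname{Tw}(\mathcal{B})$ is a finite set $V$ of generators, each carrying $\iota_\circ$ or $\iota_\bullet$, with a matrix $\delta$ over $\mathcal{B}$ with $\delta^2=0$. Here $i\xrightarrow{X^k}j$ is the entry $X^k$ from $i$ to $j$ (omitted exponent $=1$). Morphism complexes consist of all matrices over $\mathcal{B}$ compatible with idempotents, with differential the sum (over $\mathbb{F}_2$) of the two composites with the differentials of source and target. Homotopy equivalence is the corresponding notion; strict isomorphism means that an isomorphism of idempotent modules carries one differential to the other. $(N,b)$ denotes the object with generators $V_N$ and differential $\delta_N+b$, when $(\delta_N+b)^2=0$; this holds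 for all four $b_s$ below. **The complex $N$.** Generators $V_N=\{0,1,2,3,4,5,6,7,8,9,10,13,14,15,16,17,18,19,20,21,22,23,26,27,30,31,32,33,34,35,36\}$; those in $\{1,2,5,6,15,16,20,21,32,33\}$ carry $\iota_\circ$, the others $\iota_\bullet$. Differential \begin{align*} \delta_N={}&17\xrightarrow{R}18+16\xrightarrow{M}17+16\xrightarrow{L}15+15\xrightarrow{M}14+14\xrightarrow{R}13+13\xrightarrow{M^2}10\\ &+10\xrightarrow{R}9+8\xrightarrow{M^2}9+7\xrightarrow{R}8+6\xrightarrow{M}7+6\xrightarrow{L}5+5\xrightarrow{M}4+4\xrightarrow{R}3\\ &+2\xrightarrow{M}3+2\xrightarrow{L}1+1\xrightarrow{M}0+0\xrightarrow{R}19+20\xrightarrow{M}19+20\xrightarrow{L}21+21\xrightarrow{M}22\\ &+22\xrightarrow{R}23+23\xrightarrow{M^2}26+26\xrightarrow{R}27+30\xrightarrow{M^2}27+31\xrightarrow{R}30+32\xrightarrow{M}31\\ &+32\xrightarrow{L}33+33\xrightarrow{M}34+34\xrightarrow{R}35+35\xrightarrow{M^2}36. \end{align*} **The four switches.** - $b_{S_{18}}=4\xrightarrow{R}3+22\xrightarrow{R}23+22\xrightarrow{R}3+4\xrightarrow{R}23$. - $b_{S_{25}}=6\xrightarrow{L}5+20\xrightarrow{L}21+20\xrightarrow{L}5+6\xrightarrow{L}21$. - $b_{S_{69}}=0\xrightarrow{R}19+26\xrightarrow{R}27+0\xrightarrow{R}27+26\xrightarrow{R}19$. - $b_{S_{74}}=20\xrightarrow{L}21+32\xrightarrow{L}33+20\xrightarrow{L}33+32\xrightarrow{L}21$.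 (The complex $N$ encodes the piecewise-linear immersed curve in the pillowcase modelling the perturbed traceless $\mathrm{SU}(2)$ character variety of $Q_{1/3}+Q_{1/7}$, and each $b_s$ arises by smoothing that curve equivariantly at one self-intersection orbit.) *)

theory Defs
  imports "HOL-Library.Poly_Mapping" "HOL-Library.Z2"
begin

section \<open>The two-arc algebra\<close>

datatype vertex = Circ | Bull

datatype face = L | M | R

fun other :: "vertex \<Rightarrow> vertex" where
  "other Circ = Bull"
| "other Bull = Circ"

text \<open>
  The basis. The exponent is shifted so that every value of the type is a basis element:
  \<open>LWord k\<close>, \<open>RWord k\<close> and \<open>MWord v k\<close> stand for the words with exponent \<open>k + 1\<close>, and the
  word \<open>MWord v k\<close> starts at \<open>v\<close>.
\<close>

datatype word = Idem vertex | LWord nat | RWord nat | MWord vertex nat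

fun src :: "word \<Rightarrow> vertex" where
  "src (Idem v) = v"
| "src (LWord k) = Circ"
| "src (RWord k) = Bull"
| "src (MWord v k) = v"

text \<open>The exponent of \<open>MWord v k\<close> is odd iff \<open>k\<close> is even.\<close>

fun tgt :: "word \<Rightarrow> vertex" where
  "tgt (Idem v) = v"
| "tgt (LWord k) = Circ"
| "tgt (RWord k) = Bull"
| "tgt (MWord v k) = (if even k then other v else v)"

text \<open>Words are multiplied in path order (first the left factor); \<open>None\<close> is the product \<open>0\<close>.\<close>

fun word_mult :: "word \<Rightarrow> word \<Rightarrow> word option" where
  "word_mult (Idem v) w = (if v = src w then Some w else None)"
| "word_mult w (Idem v) = (if tgt w = v then Some w else None)"
| "word_mult (LWord m) (LWord n) = Some (LWord (Suc (m + n)))"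
| "word_mult (RWord m) (RWord n) = Some (RWord (Suc (m + n)))"
| "word_mult (MWord u m) (MWord v n) =
     (if tgt (MWord u m) = v then Some (MWord u (Suc (m + n))) else None)"
| "word_mult _ _ = None"

lemma word_mult_assoc:
  "Option.bind (word_mult u v) (\<lambda>x. word_mult x w) = Option.bind (word_mult v w) (word_mult u)"
proof -
  have oth: "other (other x) = x" "other x \<noteq> x" "x \<noteq> other x" for x by (cases x; simp)+
  show ?thesis
    by (cases u; cases v; cases w) (auto simp: oth split: if_splits)
qed

text \<open>A separate type, since \<open>poly_mapping\<close> itself carries the convolution product.\<close>

typedef balg = "UNIV :: (word \<Rightarrow>\<^sub>0 bit) set" ..

setup_lifting type_definition_balg

definition word_prod :: "word \<Rightarrow> word \<Rightarrow> bit \<Rightarrow> (word \<Rightarrow>\<^sub>0 bit)" where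
  "word_prod u v c = (case word_mult u v of None \<Rightarrow> 0 | Some w \<Rightarrow> Poly_Mapping.single w c)"

definition pm_mult :: "(word \<Rightarrow>\<^sub>0 bit) \<Rightarrow> (word \<Rightarrow>\<^sub>0 bit) \<Rightarrow> (word \<Rightarrow>\<^sub>0 bit)" where
  "pm_mult a b = (\<Sum>u\<in>Poly_Mapping.keys a. \<Sum>v\<in>Poly_Mapping.keys b.
     word_prod u v (Poly_Mapping.lookup a u * Poly_Mapping.lookup b v))"

lemma word_prod_0 [simp]: "word_prod u v 0 = 0"
  by (simp add: word_prod_def split: option.split)

lemma word_prod_add: "word_prod u v (c + d) = word_prod u v c + word_prod u v d"
  by (simp add: word_prod_def single_add del: add_bit_eq_xor split: option.split)

lemma pm_mult_superset:
  assumes "finite A" "finite B" "Poly_Mapping.keys a \<subseteq> A" "Poly_Mapping.keys b \<subseteq> B"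
  shows "pm_mult a b = (\<Sum>u\<in>A. \<Sum>v\<in>B.
     word_prod u v (Poly_Mapping.lookup a u * Poly_Mapping.lookup b v))"
proof -
  have "pm_mult a b = (\<Sum>u\<in>Poly_Mapping.keys a. \<Sum>v\<in>B.
     word_prod u v (Poly_Mapping.lookup a u * Poly_Mapping.lookup b v))"
    unfolding pm_mult_def using assms
    by (intro sum.cong refl sum.mono_neutral_left) (auto simp: in_keys_iff)
  also have "\<dots> = (\<Sum>u\<in>A. \<Sum>v\<in>B.
     word_prod u v (Poly_Mapping.lookup a u * Poly_Mapping.lookup b v))"
    using assms by (intro sum.mono_neutral_left) (auto simp: in_keys_iff)
  finally show ?thesis .
qed

lemma pm_mult_add_left: "pm_mult (a + b) c = pm_mult a c + pm_mult b c"
proof -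
  let ?A = "Poly_Mapping.keys a \<union> Poly_Mapping.keys b" and ?C = "Poly_Mapping.keys c"
  have fin: "finite ?A" "finite ?C" by simp_all
  have sub: "Poly_Mapping.keys (a + b) \<subseteq> ?A" "Poly_Mapping.keys a \<subseteq> ?A"
    "Poly_Mapping.keys b \<subseteq> ?A" by (rule keys_add) blast+
  show ?thesis
    unfolding sub(1-3)[THEN pm_mult_superset[OF fin], OF order_refl]
      lookup_add distrib_right word_prod_add sum.distrib ..
qed

lemma pm_mult_add_right: "pm_mult c (a + b) = pm_mult c a + pm_mult c b"
proof -
  let ?A = "Poly_Mapping.keys a \<union> Poly_Mapping.keys b" and ?C = "Poly_Mapping.keys c"
  have fin: "finite ?C" "finite ?A" by simp_all
  have sub: "Poly_Mapping.keys (a + b) \<subseteq> ?A" "Poly_Mapping.keys a \<subseteq> ?A"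
    "Poly_Mapping.keys b \<subseteq> ?A" by (rule keys_add) blast+
  show ?thesis
    unfolding sub(1-3)[THEN pm_mult_superset[OF fin order_refl]]
      lookup_add distrib_left word_prod_add sum.distrib ..
qed

lemma pm_mult_0 [simp]: "pm_mult 0 a = 0" "pm_mult a 0 = 0"
  by (simp_all add: pm_mult_def)

lemma pm_mult_single:
  "pm_mult (Poly_Mapping.single u c) (Poly_Mapping.single v d) = word_prod u v (c * d)"
proof (cases "c = 0 \<or> d = 0")
  case True
  then show ?thesis by (auto simp: pm_mult_def)
next
  case False
  then have "Poly_Mapping.keys (Poly_Mapping.single u c) = {u}"
    "Poly_Mapping.keys (Poly_Mapping.single v d) = {v}" by simp_all
  then show ?thesis unfolding pm_mult_def by (simp only: sum.insert sum.empty lookup_single_eq) simp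
qed

lemma pm_induct:
  assumes "P 0" "\<And>u c a. P a \<Longrightarrow> P (Poly_Mapping.single u c + a)"
  shows "P (a :: word \<Rightarrow>\<^sub>0 bit)"
proof (induction a rule: update_induct)
  case const
  show ?case by (rule assms(1))
next
  case (update f a b)
  have "Poly_Mapping.update a b f = Poly_Mapping.single a b + f"
    using update(1) by (intro poly_mapping_eqI)
      (auto simp: lookup_update lookup_add lookup_single when_def in_keys_iff)
  then show ?case using assms(2)[OF update(3)] by simp
qed

lemma pm_mult_word_prod_left:
  "pm_mult (word_prod u v c) (Poly_Mapping.single w d) =
     (case Option.bind (word_mult u v) (\<lambda>x. word_mult x w) of
        None \<Rightarrow> 0 | Some x \<Rightarrow> Poly_Mapping.single x (c * d))"
  by (cases "word_mult u v") (simp_all add: word_prod_def pm_mult_single del: mult_bit_eq_and)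

lemma pm_mult_word_prod_right:
  "pm_mult (Poly_Mapping.single u c) (word_prod v w d) =
     (case Option.bind (word_mult v w) (word_mult u) of
        None \<Rightarrow> 0 | Some x \<Rightarrow> Poly_Mapping.single x (c * d))"
  by (cases "word_mult v w") (simp_all add: word_prod_def pm_mult_single del: mult_bit_eq_and)

lemma pm_mult_assoc: "pm_mult (pm_mult a b) c = pm_mult a (pm_mult b c)"
proof (induction a rule: pm_induct)
  case (2 u x a)
  have "pm_mult (pm_mult (Poly_Mapping.single u x) b) c
      = pm_mult (Poly_Mapping.single u x) (pm_mult b c)"
  proof (induction b rule: pm_induct)
    case (2 v y b)
    have "pm_mult (pm_mult (Poly_Mapping.single u x) (Poly_Mapping.single v y)) c
        = pm_mult (Poly_Mapping.single u x) (pm_mult (Poly_Mapping.single v y) c)"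
    proof (induction c rule: pm_induct)
      case (2 w z c)
      then show ?case
        by (simp add: pm_mult_add_right pm_mult_single pm_mult_word_prod_left
            pm_mult_word_prod_right word_mult_assoc mult.assoc del: mult_bit_eq_and
            split: option.split)
    qed simp
    with 2 show ?case by (simp add: pm_mult_add_left pm_mult_add_right)
  qed simp
  with 2 show ?case by (simp add: pm_mult_add_left)
qed simp

definition pm_one :: "word \<Rightarrow>\<^sub>0 bit" where
  "pm_one = Poly_Mapping.single (Idem Circ) 1 + Poly_Mapping.single (Idem Bull) 1"

lemma word_mult_Idem_right: "word_mult w (Idem v) = (if tgt w = v then Some w else None)"
  by (cases w) auto

lemma pm_mult_one: "pm_mult pm_one a = a" "pm_mult a pm_one = a"
proof -
  have l: "pm_mult pm_one (Poly_Mapping.single w c) = Poly_Mapping.single w c" for w c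
    by (cases "src w") (simp_all add: pm_one_def pm_mult_add_left pm_mult_single word_prod_def
        del: mult_bit_eq_and)
  have r: "pm_mult (Poly_Mapping.single w c) pm_one = Poly_Mapping.single w c" for w c
    by (cases "tgt w") (simp_all add: pm_one_def pm_mult_add_right pm_mult_single word_prod_def
        word_mult_Idem_right del: mult_bit_eq_and)
  show "pm_mult pm_one a = a"
    by (induction a rule: pm_induct) (simp_all add: pm_mult_add_right l)
  show "pm_mult a pm_one = a"
    by (induction a rule: pm_induct) (simp_all add: pm_mult_add_left r)
qed

lemma pm_one_neq_zero: "pm_one \<noteq> 0"
proof
  assume "pm_one = 0"
  then have "Poly_Mapping.lookup pm_one (Idem Circ) = 0" by simp
  then show False by (simp add: pm_one_def lookup_add lookup_single)
qed

instantiation balg :: ring_1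
begin

lift_definition zero_balg :: balg is 0 .
lift_definition one_balg :: balg is pm_one .
lift_definition plus_balg :: "balg \<Rightarrow> balg \<Rightarrow> balg" is "(+)" .
lift_definition minus_balg :: "balg \<Rightarrow> balg \<Rightarrow> balg" is "(-)" .
lift_definition uminus_balg :: "balg \<Rightarrow> balg" is uminus .
lift_definition times_balg :: "balg \<Rightarrow> balg \<Rightarrow> balg" is pm_mult .

instance
  by (standard; transfer)
    (simp_all add: pm_mult_assoc pm_mult_one pm_mult_add_left pm_mult_add_right
      pm_one_neq_zero[symmetric] algebra_simps)

end

lift_definition basis :: "word \<Rightarrow> balg" is "\<lambda>w. Poly_Mapping.single w 1" .

abbreviation idem :: "vertex \<Rightarrow> balg" where
  "idem v \<equiv> basis (Idem v)"

lemma basis_mult: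
  "basis u * basis v = (case word_mult u v of None \<Rightarrow> 0 | Some w \<Rightarrow> basis w)"
  by (cases "word_mult u v"; transfer) (simp_all add: pm_mult_single word_prod_def)

lemma one_balg_eq: "(1 :: balg) = idem Circ + idem Bull"
  by transfer (simp add: pm_one_def)

lemma balg_add_self [simp]: "a + a = (0 :: balg)"
  by transfer (rule poly_mapping_eqI, simp only: lookup_add, simp)


section \<open>Twisted complexes\<close>

text \<open>
  An entry \<open>f i j\<close> of a matrix is the component from \<open>i\<close> to \<open>j\<close>; composites are taken in path
  order. Since \<open>\<F>\<^sub>2\<close> has characteristic two and there is no grading, no signs occur.
\<close>

record 'v tw =
  gens :: "'v set"
  vert :: "'v \<Rightarrow> vertex"
  tdiff :: "'v \<Rightarrow> 'v \<Rightarrow> balg"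

definition tw_hom :: "'v tw \<Rightarrow> 'w tw \<Rightarrow> ('v \<Rightarrow> 'w \<Rightarrow> balg) set" where
  "tw_hom A B = {f. \<forall>i j. if i \<in> gens A \<and> j \<in> gens B
     then idem (vert A i) * f i j * idem (vert B j) = f i j else f i j = 0}"

text \<open>\<open>mcomp B f g\<close> is first \<open>f\<close>, then \<open>g\<close>; the sum runs over the middle object \<open>B\<close>.\<close>

definition mcomp :: "'w tw \<Rightarrow> ('v \<Rightarrow> 'w \<Rightarrow> balg) \<Rightarrow> ('w \<Rightarrow> 'x \<Rightarrow> balg) \<Rightarrow> 'v \<Rightarrow> 'x \<Rightarrow> balg" where
  "mcomp B f g = (\<lambda>i k. \<Sum>j\<in>gens B. f i j * g j k)"

definition madd :: "('v \<Rightarrow> 'w \<Rightarrow> balg) \<Rightarrow> ('v \<Rightarrow> 'w \<Rightarrow> balg) \<Rightarrow> 'v \<Rightarrow> 'w \<Rightarrow> balg" where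
  "madd f g = (\<lambda>i j. f i j + g i j)"

definition mzero :: "'v \<Rightarrow> 'w \<Rightarrow> balg" where
  "mzero = (\<lambda>i j. 0)"

definition mident :: "'v tw \<Rightarrow> 'v \<Rightarrow> 'v \<Rightarrow> balg" where
  "mident A = (\<lambda>i j. if i = j \<and> i \<in> gens A then idem (vert A i) else 0)"

definition tw_object :: "'v tw \<Rightarrow> bool" where
  "tw_object A \<longleftrightarrow> finite (gens A) \<and> tdiff A \<in> tw_hom A A \<and> mcomp A (tdiff A) (tdiff A) = mzero"

definition mor_diff :: "'v tw \<Rightarrow> 'w tw \<Rightarrow> ('v \<Rightarrow> 'w \<Rightarrow> balg) \<Rightarrow> 'v \<Rightarrow> 'w \<Rightarrow> balg" where
  "mor_diff A B f = madd (mcomp A (tdiff A) f) (mcomp B f (tdiff B))"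

definition homotopy_equivalent :: "'v tw \<Rightarrow> 'w tw \<Rightarrow> bool" where
  "homotopy_equivalent A B \<longleftrightarrow>
     (\<exists>f\<in>tw_hom A B. \<exists>g\<in>tw_hom B A. \<exists>h\<in>tw_hom A A. \<exists>k\<in>tw_hom B B.
        mor_diff A B f = mzero \<and> mor_diff B A g = mzero \<and>
        madd (mcomp B f g) (mident A) = mor_diff A A h \<and>
        madd (mcomp A g f) (mident B) = mor_diff B B k)"

definition homotopy_class :: "'v tw \<Rightarrow> 'v tw set" where
  "homotopy_class A = {B. tw_object B \<and> homotopy_equivalent A B}"

text \<open>
  Morphisms of the underlying modules over the idempotent subring \<open>\<F>\<^sub>2\<langle>\<iota>\<^sub>\<circ>, \<iota>\<^sub>\<bullet>\<rangle>\<close>: the matrices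
  all of whose entries lie in that subring.
\<close>

definition idem_hom :: "'v tw \<Rightarrow> 'w tw \<Rightarrow> ('v \<Rightarrow> 'w \<Rightarrow> balg) set" where
  "idem_hom A B = {f \<in> tw_hom A B. \<forall>i j. f i j \<in> {0, idem Circ, idem Bull, 1}}"

definition strictly_isomorphic :: "'v tw \<Rightarrow> 'w tw \<Rightarrow> bool" where
  "strictly_isomorphic A B \<longleftrightarrow>
     (\<exists>p\<in>idem_hom A B. \<exists>q\<in>idem_hom B A.
        mcomp B p q = mident A \<and> mcomp A q p = mident B \<and>
        mcomp A (tdiff A) p = mcomp B p (tdiff B))"


section \<open>The complex \<open>N\<close> and the four switches\<close>

text \<open>
  An arrow \<open>(i, X, k, j)\<close> is the matrix with the single entry \<open>X\<^sup>k\<close> (\<open>k \<ge> 1\<close>) from \<open>i\<close> to \<open>j\<close>.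
  Repeated arrows cancel.
\<close>

type_synonym arrow = "nat \<times> face \<times> nat \<times> nat"

fun face_word :: "vertex \<Rightarrow> face \<Rightarrow> nat \<Rightarrow> word" where
  "face_word v L k = LWord (k - 1)"
| "face_word v M k = MWord v (k - 1)"
| "face_word v R k = RWord (k - 1)"

definition arrow_matrix :: "(nat \<Rightarrow> vertex) \<Rightarrow> arrow list \<Rightarrow> nat \<Rightarrow> nat \<Rightarrow> balg" where
  "arrow_matrix vt as = (\<lambda>i j. \<Sum>(a, X, k, b)\<leftarrow>as.
     if a = i \<and> b = j then basis (face_word (vt a) X k) else 0)"

definition V_N :: "nat set" where
  "V_N = {0,1,2,3,4,5,6,7,8,9,10,13,14,15,16,17,18,19,20,21,22,23,26,27,30,31,32,33,34,35,36}"

definition vert_N :: "nat \<Rightarrow> vertex" where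
  "vert_N i = (if i \<in> {1,2,5,6,15,16,20,21,32,33} then Circ else Bull)"

definition arrows_N :: "arrow list" where
  "arrows_N =
    [(17,R,1,18), (16,M,1,17), (16,L,1,15), (15,M,1,14), (14,R,1,13), (13,M,2,10),
     (10,R,1,9), (8,M,2,9), (7,R,1,8), (6,M,1,7), (6,L,1,5), (5,M,1,4), (4,R,1,3),
     (2,M,1,3), (2,L,1,1), (1,M,1,0), (0,R,1,19), (20,M,1,19), (20,L,1,21), (21,M,1,22),
     (22,R,1,23), (23,M,2,26), (26,R,1,27), (30,M,2,27), (31,R,1,30), (32,M,1,31),
     (32,L,1,33), (33,M,1,34), (34,R,1,35), (35,M,2,36)]"

datatype switch = S18 | S25 | S69 | S74

fun arrows_b :: "switch \<Rightarrow> arrow list" where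
  "arrows_b S18 = [(4,R,1,3), (22,R,1,23), (22,R,1,3), (4,R,1,23)]"
| "arrows_b S25 = [(6,L,1,5), (20,L,1,21), (20,L,1,5), (6,L,1,21)]"
| "arrows_b S69 = [(0,R,1,19), (26,R,1,27), (0,R,1,27), (26,R,1,19)]"
| "arrows_b S74 = [(20,L,1,21), (32,L,1,33), (20,L,1,33), (32,L,1,21)]"

definition delta_N :: "nat \<Rightarrow> nat \<Rightarrow> balg" where
  "delta_N = arrow_matrix vert_N arrows_N"

definition switch_matrix :: "switch \<Rightarrow> nat \<Rightarrow> nat \<Rightarrow> balg" where
  "switch_matrix s = arrow_matrix vert_N (arrows_b s)"

definition N_with :: "switch \<Rightarrow> nat tw" where
  "N_with s = \<lparr>gens = V_N, vert = vert_N, tdiff = madd delta_N (switch_matrix s)\<rparr>"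

end

theory Submission
  imports Defs
begin

text \<open>
  In each of the four complexes every generator has at most one incoming and one outgoing arrow
  with a given label. For homotopy inverse chain maps \<open>f\<close> and \<open>g\<close> relate \<open>a\<close> to \<open>b\<close> if an
  idempotent occurs both in \<open>f a b\<close> and in \<open>g b a\<close>. No entry of a differential contains an
  idempotent, so \<open>fg\<close> is the identity up to longer words and every \<open>a\<close> is related to some \<open>b\<close>.
  Comparing coefficients in \<open>\<delta>f = f\<delta>\<close> and \<open>\<delta>g = g\<delta>\<close> carries the relation along arrows of
  equal label, forwards and backwards. Hence every walk through \<open>a\<close> is matched by a walk with the
  same labels and directions through \<open>b\<close>. The walk \<open>M R M\<^sup>-\<^sup>2\<close> around the generator \<open>0\<close> occurs
  only in \<open>S69\<close>, and no generator of \<open>S18\<close> has both walks \<open>L M R M\<^sup>2\<close> and \<open>M R\<^sup>-\<^sup>1\<close>, which leave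
  the generator \<open>20\<close> of \<open>S74\<close>. Exchanging \<open>4\<close> with \<open>22\<close> and \<open>5\<close> with \<open>21\<close> turns \<open>S18\<close>
  into \<open>S25\<close>.
\<close>

section \<open>Coefficients\<close>

lift_definition coeff :: "balg \<Rightarrow> word \<Rightarrow> bit" is Poly_Mapping.lookup .

lemma coeff_zero [simp]: "coeff 0 w = 0"
  by transfer simp

lemma coeff_add: "coeff (a + b) w = coeff a w + coeff b w"
  by transfer (rule lookup_add)

lemma coeff_sum: "coeff (sum f S) w = (\<Sum>x\<in>S. coeff (f x) w)"
  by (induction S rule: infinite_finite_induct) (simp_all add: coeff_add del: add_bit_eq_xor)

lemma coeff_basis: "coeff (basis u) w = (if u = w then 1 else 0)"
  by transfer (simp add: lookup_single when_def)

lemma word_mult_Idem_src [simp]: "word_mult (Idem (src w)) w = Some w"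
  by simp

lemma word_mult_Idem_tgt [simp]: "word_mult w (Idem (tgt w)) = Some w"
  by (simp add: word_mult_Idem_right)

text \<open>Since \<open>w\<close> factors through \<open>u\<close> at most trivially, the only term
  of \<open>x\<close> that can produce \<open>w\<close> is the idempotent at its source. Multiplying
  by an arrow label thus reads off an idempotent coefficient.\<close>

lemma coeff_mult_basis:
  assumes factor: "\<And>v. word_mult v u = Some w \<Longrightarrow> u = w \<and> v = Idem (src w)"
  shows "coeff (x * basis u) w = (if u = w then coeff x (Idem (src w)) else 0)"
proof (transfer fixing: u w)
  fix x :: "word \<Rightarrow>\<^sub>0 bit"
  have iff: "word_mult v u = Some w \<longleftrightarrow> u = w \<and> v = Idem (src w)" for v
    using factor[of v] word_mult_Idem_src[of w] by metis
  show "Poly_Mapping.lookup (pm_mult x (Poly_Mapping.single u 1)) w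
      = (if u = w then Poly_Mapping.lookup x (Idem (src w)) else 0)"
  proof (induction x rule: pm_induct)
    case (2 v c x)
    have eq: "Poly_Mapping.lookup (word_prod v u c) w = (if u = w \<and> v = Idem (src w) then c else 0)"
      unfolding iff[symmetric]
      by (simp add: word_prod_def lookup_single when_def split: option.split)
    show ?case
      unfolding pm_mult_add_left pm_mult_single lookup_add mult_1_right eq 2
      by (simp add: lookup_single when_def del: add_bit_eq_xor)
  qed simp
qed

lemma coeff_basis_mult:
  assumes factor: "\<And>v. word_mult u v = Some w \<Longrightarrow> u = w \<and> v = Idem (tgt w)"
  shows "coeff (basis u * x) w = (if u = w then coeff x (Idem (tgt w)) else 0)"
proof (transfer fixing: u w)
  fix x :: "word \<Rightarrow>\<^sub>0 bit"
  have iff: "word_mult u v = Some w \<longleftrightarrow> u = w \<and> v = Idem (tgt w)" for v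
    using factor[of v] word_mult_Idem_tgt[of w] by metis
  show "Poly_Mapping.lookup (pm_mult (Poly_Mapping.single u 1) x) w
      = (if u = w then Poly_Mapping.lookup x (Idem (tgt w)) else 0)"
  proof (induction x rule: pm_induct)
    case (2 v c x)
    have eq: "Poly_Mapping.lookup (word_prod u v c) w = (if u = w \<and> v = Idem (tgt w) then c else 0)"
      unfolding iff[symmetric]
      by (simp add: word_prod_def lookup_single when_def split: option.split)
    show ?case
      unfolding pm_mult_add_right pm_mult_single lookup_add mult_1_left eq 2
      by (simp add: lookup_single when_def del: add_bit_eq_xor)
  qed simp
qed

lemma word_mult_eq_Idem: "word_mult u v = Some (Idem z) \<longleftrightarrow> u = Idem z \<and> v = Idem z"
  by (cases u; cases v) (auto split: if_splits)

text \<open>Positive words span a two-sided ideal, so idempotents alone contribute: each idempotent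
  coefficient is a ring homomorphism to the field with two elements.\<close>

lemma coeff_mult_Idem: "coeff (x * y) (Idem z) = coeff x (Idem z) * coeff y (Idem z)"
proof (transfer fixing: z)
  fix x y :: "word \<Rightarrow>\<^sub>0 bit"
  show "Poly_Mapping.lookup (pm_mult x y) (Idem z) = Poly_Mapping.lookup x (Idem z) * Poly_Mapping.lookup y (Idem z)"
  proof (induction x rule: pm_induct)
    case (2 u c x)
    have "Poly_Mapping.lookup (pm_mult (Poly_Mapping.single u c) y) (Idem z)
        = Poly_Mapping.lookup (Poly_Mapping.single u c) (Idem z) * Poly_Mapping.lookup y (Idem z)"
    proof (induction y rule: pm_induct)
      case (2 v d y)
      have "Poly_Mapping.lookup (word_prod u v (c * d)) (Idem z)
          = Poly_Mapping.lookup (Poly_Mapping.single u c) (Idem z) * Poly_Mapping.lookup (Poly_Mapping.single v d) (Idem z)"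
        using word_mult_eq_Idem[of u v z]
        by (cases "word_mult u v") (auto simp: word_prod_def lookup_single when_def)
      with 2 show ?case
        by (simp add: pm_mult_add_right pm_mult_single lookup_add distrib_left
            del: add_bit_eq_xor mult_bit_eq_and)
    qed simp
    with 2 show ?case
      by (simp add: pm_mult_add_left lookup_add distrib_right
          del: add_bit_eq_xor mult_bit_eq_and)
  qed simp
qed

lemma balg_add_eq_0_iff: "a + b = 0 \<longleftrightarrow> a = (b :: balg)"
  by (metis add.assoc add.right_neutral balg_add_self add_0)

section \<open>The category of twisted complexes\<close>

lemma mcomp_assoc: "mcomp C (mcomp B f g) h = mcomp B f (mcomp C g h)"
  unfolding mcomp_def
  by (intro ext, simp add: sum_distrib_left sum_distrib_right mult.assoc, rule sum.swap)

lemma mcomp_madd_left: "mcomp B (madd f g) h = madd (mcomp B f h) (mcomp B g h)"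
  by (simp add: mcomp_def madd_def distrib_right sum.distrib)

lemma mcomp_madd_right: "mcomp B f (madd g h) = madd (mcomp B f g) (mcomp B f h)"
  by (simp add: mcomp_def madd_def distrib_left sum.distrib)

lemma mcomp_mzero_left [simp]: "mcomp B mzero f = mzero"
  by (simp add: mcomp_def mzero_def)

lemma mcomp_mzero_right [simp]: "mcomp B f mzero = mzero"
  by (simp add: mcomp_def mzero_def)

lemma madd_mzero [simp]: "madd mzero f = f" "madd f mzero = f"
  by (simp_all add: madd_def mzero_def)

lemma madd_self [simp]: "madd f f = mzero"
  by (simp add: madd_def mzero_def)

lemma madd_assoc: "madd (madd f g) h = madd f (madd g h)"
  by (simp add: madd_def add.assoc)

lemma madd_commute: "madd f g = madd g f"
  by (simp add: madd_def add.commute)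

lemma madd_left_commute: "madd f (madd g h) = madd g (madd f h)"
  by (simp add: madd_def add.left_commute)

lemmas madd_ac = madd_assoc madd_commute madd_left_commute

lemma madd_left_self [simp]: "madd f (madd f g) = g"
  by (simp flip: madd_assoc)

lemma madd_eq_mzero_iff: "madd f g = mzero \<longleftrightarrow> f = g"
  by (auto simp: madd_def mzero_def fun_eq_iff balg_add_eq_0_iff)

lemma madd_eq_iff: "madd f g = h \<longleftrightarrow> f = madd g h"
  by (metis madd_assoc madd_commute madd_mzero(1) madd_self)

lemma idem_idem: "idem u * idem v = (if u = v then idem u else 0)"
  by (simp add: basis_mult)

lemma tw_homI:
  assumes "\<And>i j. i \<in> gens A \<Longrightarrow> j \<in> gens B \<Longrightarrow> idem (vert A i) * f i j * idem (vert B j) = f i j"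
    and "\<And>i j. i \<notin> gens A \<or> j \<notin> gens B \<Longrightarrow> f i j = 0"
  shows "f \<in> tw_hom A B"
  using assms by (simp add: tw_hom_def)

lemma tw_hom_zero: "f \<in> tw_hom A B \<Longrightarrow> i \<notin> gens A \<or> j \<notin> gens B \<Longrightarrow> f i j = 0"
  unfolding tw_hom_def by (auto split: if_splits)

lemma tw_hom_idem:
  "f \<in> tw_hom A B \<Longrightarrow> i \<in> gens A \<Longrightarrow> j \<in> gens B \<Longrightarrow>
    idem (vert A i) * f i j * idem (vert B j) = f i j"
  unfolding tw_hom_def by (auto split: if_splits)

lemma tw_hom_idem_left:
  assumes "f \<in> tw_hom A B" "i \<in> gens A" shows "idem (vert A i) * f i j = f i j"
proof (cases "j \<in> gens B")
  case True
  then have "idem (vert A i) * f i j = idem (vert A i) * (idem (vert A i) * f i j * idem (vert B j))"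
    using assms by (simp add: tw_hom_idem)
  also have "\<dots> = idem (vert A i) * f i j * idem (vert B j)"
    by (simp add: idem_idem flip: mult.assoc)
  finally show ?thesis using assms True by (simp add: tw_hom_idem)
qed (use assms in \<open>simp add: tw_hom_zero\<close>)

lemma tw_hom_idem_right:
  assumes "f \<in> tw_hom A B" "j \<in> gens B" shows "f i j * idem (vert B j) = f i j"
proof (cases "i \<in> gens A")
  case True
  then have "f i j * idem (vert B j) = idem (vert A i) * f i j * idem (vert B j) * idem (vert B j)"
    using assms by (simp add: tw_hom_idem)
  also have "\<dots> = idem (vert A i) * f i j * idem (vert B j)"
    by (simp add: idem_idem mult.assoc)
  finally show ?thesis using assms True by (simp add: tw_hom_idem)
qed (use assms in \<open>simp add: tw_hom_zero\<close>)

lemma tw_hom_mcomp: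
  assumes "f \<in> tw_hom A B" "g \<in> tw_hom B C" shows "mcomp B f g \<in> tw_hom A C"
proof (rule tw_homI)
  fix i k assume "i \<in> gens A" "k \<in> gens C"
  then show "idem (vert A i) * mcomp B f g i k * idem (vert C k) = mcomp B f g i k"
    unfolding mcomp_def sum_distrib_left sum_distrib_right
    by (intro sum.cong refl)
      (metis assms mult.assoc tw_hom_idem_left tw_hom_idem_right)
next
  fix i k assume "i \<notin> gens A \<or> k \<notin> gens C"
  then show "mcomp B f g i k = 0"
    unfolding mcomp_def using assms
    by (intro sum.neutral) (auto simp: tw_hom_zero)
qed

lemma tw_hom_madd:
  assumes "f \<in> tw_hom A B" "g \<in> tw_hom A B" shows "madd f g \<in> tw_hom A B"
  using assms
  by (intro tw_homI) (auto simp: madd_def distrib_left distrib_right tw_hom_idem tw_hom_zero)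

lemma tw_hom_mzero: "mzero \<in> tw_hom A B"
  by (intro tw_homI) (auto simp: mzero_def)

lemma tw_hom_mident: "mident A \<in> tw_hom A A"
  by (intro tw_homI) (auto simp: mident_def idem_idem)

lemma mcomp_mident_left:
  assumes "finite (gens A)" "f \<in> tw_hom A B" shows "mcomp A (mident A) f = f"
proof (intro ext)
  fix i k
  have "mcomp A (mident A) f i k = (\<Sum>j\<in>gens A. if i = j then idem (vert A i) * f i k else 0)"
    unfolding mcomp_def mident_def by (intro sum.cong) auto
  also have "\<dots> = f i k"
    using assms by (auto simp: tw_hom_idem_left tw_hom_zero)
  finally show "mcomp A (mident A) f i k = f i k" .
qed

lemma mcomp_mident_right:
  assumes "finite (gens B)" "f \<in> tw_hom A B" shows "mcomp B f (mident B) = f"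
proof (intro ext)
  fix i k
  have "mcomp B f (mident B) i k = (\<Sum>j\<in>gens B. if j = k then f i k * idem (vert B k) else 0)"
    unfolding mcomp_def mident_def by (intro sum.cong) auto
  also have "\<dots> = f i k"
    using assms by (auto simp: tw_hom_idem_right tw_hom_zero)
  finally show "mcomp B f (mident B) i k = f i k" .
qed

section \<open>Homotopies and homotopy equivalence\<close>

lemma mor_diff_madd: "mor_diff A B (madd f g) = madd (mor_diff A B f) (mor_diff A B g)"
  by (simp add: mor_diff_def mcomp_madd_left mcomp_madd_right madd_ac)

lemma mor_diff_mzero [simp]: "mor_diff A B mzero = mzero"
  by (simp add: mor_diff_def)

text \<open>The Leibniz rule: the two terms containing the differential of \<open>B\<close> cancel
  in characteristic two.\<close>

lemma mor_diff_mcomp: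
  "mor_diff A C (mcomp B f g) = madd (mcomp B (mor_diff A B f) g) (mcomp B f (mor_diff B C g))"
  by (simp add: mor_diff_def mcomp_madd_left mcomp_madd_right mcomp_assoc madd_assoc)

lemma homotopy_equivalent_sym: "homotopy_equivalent A B \<Longrightarrow> homotopy_equivalent B A"
  unfolding homotopy_equivalent_def by blast

text \<open>First \<open>f'g'\<close> is contracted to the identity of \<open>B\<close> by
  \<open>h'\<close>, conjugated with \<open>f\<close> and \<open>g\<close>; then \<open>fg\<close>
  is contracted by \<open>h\<close>. Transitivity uses this once in each direction.\<close>

lemma homotopic_mcomp:
  assumes fin: "finite (gens B)" and g: "g \<in> tw_hom B A"
    and df: "mor_diff A B f = mzero" and dg: "mor_diff B A g = mzero"
    and h: "madd (mcomp B f g) (mident A) = mor_diff A A h"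
    and h': "madd (mcomp C f' g') (mident B) = mor_diff B B h'"
  shows "madd (mcomp C (mcomp B f f') (mcomp B g' g)) (mident A)
      = mor_diff A A (madd h (mcomp B f (mcomp B h' g)))"
proof -
  have fg': "mcomp C f' g' = madd (mident B) (mor_diff B B h')"
    using h' by (simp add: madd_eq_iff)
  have "mcomp C (mcomp B f f') (mcomp B g' g) = mcomp B f (mcomp B (mcomp C f' g') g)"
    by (simp add: mcomp_assoc)
  also have "\<dots> = madd (mcomp B f g) (mor_diff A A (mcomp B f (mcomp B h' g)))"
    using fin g by (simp add: fg' mcomp_madd_left mcomp_madd_right mcomp_mident_left
        mor_diff_mcomp df dg)
  finally show ?thesis
    by (simp add: mor_diff_madd madd_ac flip: h)
qed

lemma homotopy_equivalent_trans:
  assumes fin: "finite (gens B)" and AB: "homotopy_equivalent A B" and BC: "homotopy_equivalent B C"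
  shows "homotopy_equivalent A C"
proof -
  obtain f g h k where 1: "f \<in> tw_hom A B" "g \<in> tw_hom B A" "h \<in> tw_hom A A" "k \<in> tw_hom B B"
      "mor_diff A B f = mzero" "mor_diff B A g = mzero"
      "madd (mcomp B f g) (mident A) = mor_diff A A h"
      "madd (mcomp A g f) (mident B) = mor_diff B B k"
    using AB unfolding homotopy_equivalent_def by blast
  obtain f' g' h' k' where 2: "f' \<in> tw_hom B C" "g' \<in> tw_hom C B" "h' \<in> tw_hom B B" "k' \<in> tw_hom C C"
      "mor_diff B C f' = mzero" "mor_diff C B g' = mzero"
      "madd (mcomp C f' g') (mident B) = mor_diff B B h'"
      "madd (mcomp B g' f') (mident C) = mor_diff C C k'"
    using BC unfolding homotopy_equivalent_def by blast
  show ?thesis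
    unfolding homotopy_equivalent_def
  proof (intro bexI conjI)
    show "madd (mcomp C (mcomp B f f') (mcomp B g' g)) (mident A)
        = mor_diff A A (madd h (mcomp B f (mcomp B h' g)))"
      using fin 1 2 by (intro homotopic_mcomp)
    show "madd (mcomp A (mcomp B g' g) (mcomp B f f')) (mident C)
        = mor_diff C C (madd k' (mcomp B g' (mcomp B k f')))"
      using fin 1 2 by (intro homotopic_mcomp)
    show "mor_diff A C (mcomp B f f') = mzero" "mor_diff C A (mcomp B g' g) = mzero"
      using 1 2 by (simp_all add: mor_diff_mcomp)
  qed (use 1 2 in \<open>simp_all add: tw_hom_madd tw_hom_mcomp\<close>)
qed

lemma homotopy_equivalent_refl:
  assumes "tw_object A" shows "homotopy_equivalent A A"
  unfolding homotopy_equivalent_def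
proof (intro bexI conjI)
  have "finite (gens A)" "tdiff A \<in> tw_hom A A" using assms by (auto simp: tw_object_def)
  then show "mor_diff A A (mident A) = mzero" "mor_diff A A (mident A) = mzero"
    "madd (mcomp A (mident A) (mident A)) (mident A) = mor_diff A A mzero"
    "madd (mcomp A (mident A) (mident A)) (mident A) = mor_diff A A mzero"
    by (simp_all add: mor_diff_def mcomp_mident_left mcomp_mident_right
        mcomp_mident_left[OF _ tw_hom_mident])
qed (simp_all add: tw_hom_mident tw_hom_mzero)

lemma homotopy_class_eq:
  assumes "finite (gens A)" "finite (gens B)" "homotopy_equivalent A B"
  shows "homotopy_class A = homotopy_class B"
  unfolding homotopy_class_def
  using assms homotopy_equivalent_sym homotopy_equivalent_trans by blast

text \<open>By reflexivity, \<open>tw_object B\<close> puts \<open>B\<close> into its own class and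
  hence into that of \<open>A\<close>.\<close>

lemma homotopy_class_eqD:
  assumes "tw_object B" "homotopy_class A = homotopy_class B"
  shows "homotopy_equivalent A B"
  using assms homotopy_equivalent_refl[of B] unfolding homotopy_class_def by blast

text \<open>The definition makes only \<open>p\<close> a chain map; its inverse \<open>q\<close>
  then is one too, and zero homotopies suffice.\<close>

lemma strictly_isomorphic_imp_homotopy_equivalent:
  assumes "tw_object A" "tw_object B" "strictly_isomorphic A B"
  shows "homotopy_equivalent A B"
proof -
  obtain p q where p: "p \<in> tw_hom A B" and q: "q \<in> tw_hom B A"
      and pq: "mcomp B p q = mident A" and qp: "mcomp A q p = mident B"
      and dp: "mcomp A (tdiff A) p = mcomp B p (tdiff B)"
    using assms(3) unfolding strictly_isomorphic_def idem_hom_def by blast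
  have A: "finite (gens A)" "tdiff A \<in> tw_hom A A" and B: "finite (gens B)" "tdiff B \<in> tw_hom B B"
    using assms by (auto simp: tw_object_def)
  \<comment> \<open>Writing d for either differential:
    \<open>q d = q d p q = q p d q = d q\<close>.\<close>
  have "mcomp A q (tdiff A) = mcomp A q (mcomp A (tdiff A) (mcomp B p q))"
    using A by (simp add: pq mcomp_mident_right)
  also have "\<dots> = mcomp A q (mcomp B (mcomp A (tdiff A) p) q)"
    by (simp add: mcomp_assoc)
  also have "\<dots> = mcomp B (mcomp A q p) (mcomp B (tdiff B) q)"
    by (simp add: dp mcomp_assoc)
  also have "\<dots> = mcomp B (tdiff B) q"
    using B(1) tw_hom_mcomp[OF B(2) q] by (simp add: qp mcomp_mident_left)
  finally have "mor_diff B A q = mzero"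
    by (simp add: mor_diff_def)
  moreover have "mor_diff A B p = mzero"
    by (simp add: mor_diff_def dp)
  ultimately show ?thesis
    unfolding homotopy_equivalent_def using p q pq qp
    by (intro bexI[of _ p] bexI[of _ q] bexI[of _ mzero])
      (simp_all add: tw_hom_mzero)
qed

section \<open>Complexes of strings and bands\<close>

text \<open>All labels that occur in the four complexes: \<open>L\<close>, \<open>R\<close>,
  \<open>M\<close> starting at \<open>Circ\<close>, and the square of \<open>M\<close> starting at
  \<open>Bull\<close>.\<close>

definition short_words :: "word set" where
  "short_words = {LWord 0, RWord 0, MWord Circ 0, MWord Bull 1}"

definition word_differential :: "('v \<times> word \<times> 'v) set \<Rightarrow> 'v \<Rightarrow> 'v \<Rightarrow> balg" where
  "word_differential E = (\<lambda>i j. \<Sum>(x, u, y)\<in>E. if x = i \<and> y = j then basis u else 0)"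

text \<open>Uniqueness of arrows reduces the sums in coefficient comparisons to single terms.
  \<open>in_M\<close> separates the only two short words of which one is a proper suffix of the
  other.\<close>

locale string_complex =
  fixes A :: "'v tw" and E :: "('v \<times> word \<times> 'v) set"
  assumes finite_gens: "finite (gens A)"
    and finite_arrows: "finite E"
    and tdiff_eq: "tdiff A = word_differential E"
    and gens: "(x, u, y) \<in> E \<Longrightarrow> x \<in> gens A \<and> y \<in> gens A"
    and vert: "(x, u, y) \<in> E \<Longrightarrow> src u = vert A x \<and> tgt u = vert A y"
    and short: "(x, u, y) \<in> E \<Longrightarrow> u \<in> short_words"
    and out_unique: "(x, u, y) \<in> E \<Longrightarrow> (x, u, y') \<in> E \<Longrightarrow> y = y'"
    and in_unique: "(x, u, y) \<in> E \<Longrightarrow> (x', u, y) \<in> E \<Longrightarrow> x = x'"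
    and in_M: "(x, MWord Circ 0, y) \<in> E \<Longrightarrow> (x', MWord Bull 1, y) \<notin> E"
begin

text \<open>After exchanging the sums, each arrow leaves a single term, because its endpoint is a
  generator.\<close>

lemma tdiff_mcomp:
  "mcomp A (tdiff A) f = (\<lambda>i k. \<Sum>(x, u, y)\<in>E. if x = i then basis u * f y k else 0)"
proof (intro ext)
  fix i k
  have "mcomp A (tdiff A) f i k
      = (\<Sum>e\<in>E. \<Sum>j\<in>gens A. case e of (x, u, y) \<Rightarrow> if x = i \<and> y = j then basis u * f j k else 0)"
    unfolding mcomp_def tdiff_eq word_differential_def sum_distrib_right
    by (subst sum.swap) (intro sum.cong refl, auto)
  also have "\<dots> = (\<Sum>(x, u, y)\<in>E. if x = i then basis u * f y k else 0)"
  proof (intro sum.cong refl, clarify)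
    fix x u y assume "(x, u, y) \<in> E"
    then have "y \<in> gens A" by (simp add: gens)
    moreover have "(\<Sum>j\<in>gens A. if x = i \<and> y = j then basis u * f j k else 0)
        = (\<Sum>j\<in>gens A. if y = j then if x = i then basis u * f j k else 0 else 0)"
      by (intro sum.cong) auto
    ultimately show "(\<Sum>j\<in>gens A. if x = i \<and> y = j then basis u * f j k else 0)
        = (if x = i then basis u * f y k else 0)"
      by (simp add: finite_gens)
  qed
  finally show "mcomp A (tdiff A) f i k = (\<Sum>(x, u, y)\<in>E. if x = i then basis u * f y k else 0)" .
qed

lemma mcomp_tdiff:
  "mcomp A f (tdiff A) = (\<lambda>i k. \<Sum>(x, u, y)\<in>E. if y = k then f i x * basis u else 0)"
proof (intro ext)
  fix i k
  have "mcomp A f (tdiff A) i k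
      = (\<Sum>e\<in>E. \<Sum>j\<in>gens A. case e of (x, u, y) \<Rightarrow> if x = j \<and> y = k then f i j * basis u else 0)"
    unfolding mcomp_def tdiff_eq word_differential_def sum_distrib_left
    by (subst sum.swap) (intro sum.cong refl, auto)
  also have "\<dots> = (\<Sum>(x, u, y)\<in>E. if y = k then f i x * basis u else 0)"
  proof (intro sum.cong refl, clarify)
    fix x u y assume "(x, u, y) \<in> E"
    then have "x \<in> gens A" by (simp add: gens)
    moreover have "(\<Sum>j\<in>gens A. if x = j \<and> y = k then f i j * basis u else 0)
        = (\<Sum>j\<in>gens A. if x = j then if y = k then f i j * basis u else 0 else 0)"
      by (intro sum.cong) auto
    ultimately show "(\<Sum>j\<in>gens A. if x = j \<and> y = k then f i j * basis u else 0)
        = (if y = k then f i x * basis u else 0)"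
      by (simp add: finite_gens)
  qed
  finally show "mcomp A f (tdiff A) i k = (\<Sum>(x, u, y)\<in>E. if y = k then f i x * basis u else 0)" .
qed

text \<open>No short word is a proper prefix of another: the square of \<open>M\<close> from
  \<open>Bull\<close> begins with \<open>M\<close> from \<open>Bull\<close>, which is not short. So
  only arrows labelled \<open>w\<close> contribute.\<close>

lemma coeff_tdiff_mcomp:
  assumes "w \<in> short_words"
  shows "coeff (mcomp A (tdiff A) f i k) w
      = (\<Sum>y | (i, w, y) \<in> E. coeff (f y k) (Idem (tgt w)))"
proof -
  have factor: "u = w \<and> v = Idem (tgt w)" if "u \<in> short_words" "word_mult u v = Some w" for u v
    using that assms by (cases v) (auto simp: short_words_def split: if_splits)
  have mult: "coeff (basis u * a) w = (if u = w then coeff a (Idem (tgt w)) else 0)"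
    if "(x, u, y) \<in> E" for x u y a
    using factor[OF short[OF that]] by (rule coeff_basis_mult)
  have "coeff (mcomp A (tdiff A) f i k) w
      = (\<Sum>(x, u, y)\<in>E. if x = i \<and> u = w then coeff (f y k) (Idem (tgt w)) else 0)"
    unfolding tdiff_mcomp coeff_sum
    by (intro sum.cong refl) (auto simp: mult)
  also have "\<dots> = (\<Sum>(x, u, y)\<in>(\<lambda>y. (i, w, y)) ` {y. (i, w, y) \<in> E}. coeff (f y k) (Idem (tgt w)))"
    by (rule sum.mono_neutral_cong_right) (auto simp: finite_arrows)
  also have "\<dots> = (\<Sum>y | (i, w, y) \<in> E. coeff (f y k) (Idem (tgt w)))"
    by (subst sum.reindex) (auto simp: inj_on_def)
  finally show ?thesis .
qed

text \<open>
  The side condition excludes the one way in which a word of \<open>short_words\<close> factors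
  through another: \<open>M\<^sup>2\<close> from \<open>\<bullet>\<close> ends in the word \<open>M\<close> from \<open>\<circ>\<close>.
\<close>

lemma coeff_mcomp_tdiff:
  assumes "w \<in> short_words" and noM: "w = MWord Bull 1 \<Longrightarrow> \<nexists>x. (x, MWord Circ 0, k) \<in> E"
  shows "coeff (mcomp A f (tdiff A) i k) w
      = (\<Sum>x | (x, w, k) \<in> E. coeff (f i x) (Idem (src w)))"
proof -
  have factor: "u = w \<and> v = Idem (src w)"
    if "u \<in> short_words" "(x, u, k) \<in> E" "word_mult v u = Some w" for x u v
    using that assms by (cases v) (auto simp: short_words_def split: if_splits)
  have mult: "coeff (a * basis u) w = (if u = w then coeff a (Idem (src w)) else 0)"
    if "(x, u, k) \<in> E" for x u a
    using factor[OF short[OF that] that] by (rule coeff_mult_basis)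
  have "coeff (mcomp A f (tdiff A) i k) w
      = (\<Sum>(x, u, y)\<in>E. if y = k \<and> u = w then coeff (f i x) (Idem (src w)) else 0)"
    unfolding mcomp_tdiff coeff_sum
    by (intro sum.cong refl) (auto simp: mult)
  also have "\<dots> = (\<Sum>(x, u, y)\<in>(\<lambda>x. (x, w, k)) ` {x. (x, w, k) \<in> E}. coeff (f i x) (Idem (src w)))"
    by (rule sum.mono_neutral_cong_right) (auto simp: finite_arrows)
  also have "\<dots> = (\<Sum>x | (x, w, k) \<in> E. coeff (f i x) (Idem (src w)))"
    by (subst sum.reindex) (auto simp: inj_on_def)
  finally show ?thesis .
qed

text \<open>Arrow labels are positive words, so null-homotopic maps are invisible to idempotent
  coefficients.\<close>

lemma coeff_tdiff_mcomp_Idem: "coeff (mcomp A (tdiff A) f i k) (Idem z) = 0"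
  unfolding tdiff_mcomp coeff_sum
  by (intro sum.neutral) (auto simp: coeff_mult_Idem coeff_basis short_words_def dest!: short)

lemma coeff_mcomp_tdiff_Idem: "coeff (mcomp A f (tdiff A) i k) (Idem z) = 0"
  unfolding mcomp_tdiff coeff_sum
  by (intro sum.neutral) (auto simp: coeff_mult_Idem coeff_basis short_words_def dest!: short)

text \<open>The square of the differential vanishes term by term, since consecutive arrows have
  product zero.\<close>

lemma tw_object_string_complex:
  assumes "\<And>x u y v z. (x, u, y) \<in> E \<Longrightarrow> (y, v, z) \<in> E \<Longrightarrow> word_mult u v = None"
  shows "tw_object A"
  unfolding tw_object_def
proof (intro conjI finite_gens)
  show "tdiff A \<in> tw_hom A A"
  proof (rule tw_homI)
    fix i j
    have "idem (vert A i) * basis u * idem (vert A j) = basis u" if "(i, u, j) \<in> E" for u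
      using vert[OF that] by (simp add: basis_mult word_mult_Idem_right)
    then show "idem (vert A i) * tdiff A i j * idem (vert A j) = tdiff A i j"
      unfolding tdiff_eq word_differential_def sum_distrib_left sum_distrib_right
      by (intro sum.cong refl) auto
  next
    fix i j assume "i \<notin> gens A \<or> j \<notin> gens A"
    then show "tdiff A i j = 0"
      unfolding tdiff_eq word_differential_def
      by (intro sum.neutral) (auto dest: gens)
  qed
  show "mcomp A (tdiff A) (tdiff A) = mzero"
    unfolding tdiff_mcomp mzero_def
  proof (intro ext sum.neutral ballI, clarify)
    fix i k x u y assume "(x, u, y) \<in> E"
    then show "(if x = i then basis u * tdiff A y k else 0) = 0"
      unfolding tdiff_eq word_differential_def sum_distrib_left
      using assms by (auto simp: basis_mult intro!: sum.neutral)
  qed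
qed

end

lemma coeff_tw_hom_neq_0:
  assumes "f \<in> tw_hom A B" "coeff (f i j) (Idem z) \<noteq> 0"
  shows "i \<in> gens A \<and> j \<in> gens B \<and> vert A i = z \<and> vert B j = z"
proof -
  have ij: "i \<in> gens A" "j \<in> gens B"
    using assms tw_hom_zero[OF assms(1)] by (metis coeff_zero)+
  have "coeff (idem (vert A i) * f i j * idem (vert B j)) (Idem z) \<noteq> 0"
    using assms ij by (simp add: tw_hom_idem)
  then show ?thesis
    using ij by (simp add: coeff_mult_Idem coeff_basis split: if_splits)
qed

text \<open>
  Both \<open>f\<close> and \<open>g\<close> enter, because the coefficients of \<open>f\<close> alone only propagate up to the
  order on strings; with \<open>g\<close> available every mismatch of arrows kills one of the two.
\<close>

definition matched where
  "matched f g a b \<longleftrightarrow> (\<exists>z. coeff (f a b) (Idem z) = 1 \<and> coeff (g b a) (Idem z) = 1)"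

lemma bit_neq_0: "(x :: bit) \<noteq> 0 \<longleftrightarrow> x = 1"
  by (cases x) auto

section \<open>Transport of matched generators along arrows\<close>

locale chain_map_pair =
  A: string_complex A E + B: string_complex B F
  for A :: "'v tw" and E and B :: "'w tw" and F +
  fixes f g
  assumes f: "f \<in> tw_hom A B"
    and df: "mor_diff A B f = mzero" and dg: "mor_diff B A g = mzero"
begin

text \<open>The coefficient of \<open>w\<close> at \<open>(a, b)\<close> in the chain map equation
  compares the arrows leaving \<open>a\<close> with those entering \<open>b\<close>.\<close>

lemma coeff_f:
  assumes "w \<in> short_words" "w = MWord Bull 1 \<Longrightarrow> \<nexists>x. (x, MWord Circ 0, b) \<in> F"
  shows "(\<Sum>y | (a, w, y) \<in> E. coeff (f y b) (Idem (tgt w)))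
      = (\<Sum>x | (x, w, b) \<in> F. coeff (f a x) (Idem (src w)))"
  using df assms unfolding mor_diff_def madd_eq_mzero_iff
  by (metis A.coeff_tdiff_mcomp B.coeff_mcomp_tdiff)

lemma coeff_g:
  assumes "w \<in> short_words" "w = MWord Bull 1 \<Longrightarrow> \<nexists>x. (x, MWord Circ 0, a) \<in> E"
  shows "(\<Sum>y | (b, w, y) \<in> F. coeff (g y a) (Idem (tgt w)))
      = (\<Sum>x | (x, w, a) \<in> E. coeff (g b x) (Idem (src w)))"
  using dg assms unfolding mor_diff_def madd_eq_mzero_iff
  by (metis B.coeff_tdiff_mcomp A.coeff_mcomp_tdiff)

lemma matched_iff:
  "matched f g a b \<longleftrightarrow>
    coeff (f a b) (Idem (vert A a)) = 1 \<and> coeff (g b a) (Idem (vert A a)) = 1"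
  unfolding matched_def using coeff_tw_hom_neq_0[OF f, of a b] by (metis zero_neq_one)

lemma arrow_sets:
  assumes "(a, w, a') \<in> E"
  shows "{y. (a, w, y) \<in> E} = {a'}" "{x. (x, w, a') \<in> E} = {a}"
  using assms A.out_unique A.in_unique by blast+

lemma arrow_sets':
  assumes "(b, w, b') \<in> F"
  shows "{y. (b, w, y) \<in> F} = {b'}" "{x. (x, w, b') \<in> F} = {b}"
  using assms B.out_unique B.in_unique by blast+

text \<open>The equation for \<open>g\<close> at \<open>(b, a')\<close> produces the arrow from
  \<open>b\<close> to \<open>b'\<close>; the equation for \<open>f\<close> at \<open>(a, b')\<close>
  then carries the idempotent of \<open>f a b\<close> to \<open>f a' b'\<close>.\<close>

lemma matched_out:
  assumes m: "matched f g a b" and a: "(a, w, a') \<in> E"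
  shows "\<exists>b'. (b, w, b') \<in> F \<and> matched f g a' b'"
proof -
  have w: "w \<in> short_words" and v: "src w = vert A a" "tgt w = vert A a'"
    using A.short[OF a] A.vert[OF a] by auto
  have noM: "\<nexists>x. (x, MWord Circ 0, a') \<in> E" if "w = MWord Bull 1"
    using A.in_M a that by blast
  have "(\<Sum>y | (b, w, y) \<in> F. coeff (g y a') (Idem (tgt w))) = coeff (g b a) (Idem (src w))"
    using coeff_g[OF w noM, of b] by (simp add: arrow_sets[OF a] del: add_bit_eq_xor)
  then have "\<dots> \<noteq> 0 \<Longrightarrow> \<exists>b'. (b, w, b') \<in> F \<and> coeff (g b' a') (Idem (tgt w)) \<noteq> 0"
    by (metis (mono_tags, lifting) mem_Collect_eq sum.neutral)
  then obtain b' where b': "(b, w, b') \<in> F" and gb: "coeff (g b' a') (Idem (tgt w)) = 1"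
    using m v by (auto simp: matched_iff bit_neq_0)
  \<comment> \<open>The arrow just found enters \<open>b'\<close>, so \<open>B.in_M\<close> yields
    the side condition of \<open>coeff_f\<close>.\<close>
  have "coeff (f a' b') (Idem (tgt w)) = coeff (f a b) (Idem (src w))"
    using coeff_f[OF w, of b' a] B.in_M b'
    by (auto simp: arrow_sets[OF a] arrow_sets'[OF b'] simp del: add_bit_eq_xor)
  with m v gb b' show ?thesis
    by (auto simp: matched_iff)
qed

text \<open>Here \<open>f\<close> produces the arrow and \<open>g\<close> follows. The side
  condition at \<open>b'\<close> is not automatic, as no arrow into \<open>b'\<close> is known
  yet.\<close>

lemma matched_in:
  assumes m: "matched f g a' b'" and a: "(a, w, a') \<in> E"
  shows "\<exists>b. (b, w, b') \<in> F \<and> matched f g a b"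
proof -
  have w: "w \<in> short_words" and v: "src w = vert A a" "tgt w = vert A a'"
    using A.short[OF a] A.vert[OF a] by auto
  have noM: "\<nexists>x. (x, MWord Circ 0, b') \<in> F" if "w = MWord Bull 1"
  proof
    assume "\<exists>x. (x, MWord Circ 0, b') \<in> F"
    then obtain x where x: "(x, MWord Circ 0, b') \<in> F" by blast
    \<comment> \<open>An arrow \<open>M\<close> into \<open>b'\<close> without a counterpart into
      \<open>a'\<close> would force the idempotent coefficient of \<open>g b' a'\<close> to vanish,
      against the match.\<close>
    have "{x. (x, MWord Circ 0, a') \<in> E} = {}"
      using A.in_M a that by blast
    then have "coeff (g b' a') (Idem Bull) = 0"
      using coeff_g[of "MWord Circ 0" a' x] by (simp add: arrow_sets'[OF x] short_words_def del: add_bit_eq_xor)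
    with m v that show False by (simp add: matched_iff)
  qed
  have "(\<Sum>x | (x, w, b') \<in> F. coeff (f a x) (Idem (src w))) = coeff (f a' b') (Idem (tgt w))"
    using coeff_f[OF w noM, of a] by (simp add: arrow_sets[OF a] del: add_bit_eq_xor)
  then have "\<dots> \<noteq> 0 \<Longrightarrow> \<exists>b. (b, w, b') \<in> F \<and> coeff (f a b) (Idem (src w)) \<noteq> 0"
    by (metis (mono_tags, lifting) mem_Collect_eq sum.neutral)
  then obtain b where b: "(b, w, b') \<in> F" and fa: "coeff (f a b) (Idem (src w)) = 1"
    using m v by (auto simp: matched_iff bit_neq_0)
  have "\<nexists>x. (x, MWord Circ 0, a') \<in> E" if "w = MWord Bull 1"
    using A.in_M a that by blast
  from coeff_g[OF w this, of b]
  have "coeff (g b a) (Idem (src w)) = coeff (g b' a') (Idem (tgt w))"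
    by (simp add: arrow_sets[OF a] arrow_sets'[OF b] del: add_bit_eq_xor)
  with m v fa b show ?thesis
    by (auto simp: matched_iff)
qed

end

text \<open>A simulation of labelled transition systems in which arrows may also be traversed
  backwards.\<close>

definition arrow_simulation ::
    "('v \<times> 'l \<times> 'v) set \<Rightarrow> ('w \<times> 'l \<times> 'w) set \<Rightarrow> ('v \<Rightarrow> 'w \<Rightarrow> bool) \<Rightarrow> bool" where
  "arrow_simulation E F P \<longleftrightarrow> (\<forall>a b. P a b \<longrightarrow>
     (\<forall>w a'. (a, w, a') \<in> E \<longrightarrow> (\<exists>b'. (b, w, b') \<in> F \<and> P a' b')) \<and>
     (\<forall>w a'. (a', w, a) \<in> E \<longrightarrow> (\<exists>b'. (b', w, b) \<in> F \<and> P a' b')))"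

text \<open>The homotopy has no idempotent term, so on the diagonal the products
  \<open>f a b * g b a\<close> have idempotent coefficients summing to 1. Some \<open>b\<close>
  contributes, which gives a match for \<open>a\<close>.\<close>

theorem homotopy_equivalent_simulation:
  assumes A: "string_complex A E" and B: "string_complex B F" and eq: "homotopy_equivalent A B"
  shows "\<exists>P. arrow_simulation E F P \<and> (\<forall>a\<in>gens A. \<exists>b\<in>gens B. P a b)"
proof -
  interpret A: string_complex A E by fact
  interpret B: string_complex B F by fact
  obtain f g h where f: "f \<in> tw_hom A B" "mor_diff A B f = mzero"
      and g: "g \<in> tw_hom B A" "mor_diff B A g = mzero"
      and h: "madd (mcomp B f g) (mident A) = mor_diff A A h"
    using eq unfolding homotopy_equivalent_def by blast
  interpret chain_map_pair A E B F f g
    by unfold_locales (fact f g)+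
  show ?thesis
  proof (intro exI conjI ballI)
    show "arrow_simulation E F (matched f g)"
      unfolding arrow_simulation_def using matched_out matched_in by blast
    fix a assume a: "a \<in> gens A"
    let ?z = "Idem (vert A a)"
    have "coeff (mor_diff A A h a a) ?z = 0"
      by (simp add: mor_diff_def madd_def coeff_add A.coeff_tdiff_mcomp_Idem
          A.coeff_mcomp_tdiff_Idem)
    then have "coeff (mcomp B f g a a) ?z + 1 = 0"
      using a by (simp add: madd_def mident_def coeff_add coeff_basis flip: h)
    then have "(\<Sum>b\<in>gens B. coeff (f a b) ?z * coeff (g b a) ?z) \<noteq> 0"
      by (auto simp: mcomp_def coeff_sum coeff_mult_Idem)
    then obtain b where "b \<in> gens B" "coeff (f a b) ?z * coeff (g b a) ?z \<noteq> 0"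
      by (meson sum.neutral)
    then show "\<exists>b\<in>gens B. matched f g a b"
      by (auto simp: matched_def bit_neq_0)
  qed
qed

lemma arrow_simulationD:
  assumes "arrow_simulation E F P" "P a b"
  shows "(a, w, a') \<in> E \<Longrightarrow> \<exists>b'. (b, w, b') \<in> F \<and> P a' b'"
    and "(a', w, a) \<in> E \<Longrightarrow> \<exists>b'. (b', w, b) \<in> F \<and> P a' b'"
  using assms unfolding arrow_simulation_def by blast+

text \<open>The isomorphism is the permutation matrix of \<open>\<sigma>\<close>, with idempotents
  as entries; its inverse is the transpose.\<close>

lemma strictly_isomorphic_relabel:
  assumes A: "string_complex A E" and B: "string_complex B ((\<lambda>(x, u, y). (\<sigma> x, u, \<sigma> y)) ` E)"
    and bij: "bij_betw \<sigma> (gens A) (gens B)"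
    and vert: "\<And>x. x \<in> gens A \<Longrightarrow> vert B (\<sigma> x) = vert A x"
  shows "strictly_isomorphic A B"
proof -
  interpret A: string_complex A E by fact
  interpret B: string_complex B "(\<lambda>(x, u, y). (\<sigma> x, u, \<sigma> y)) ` E" by fact
  have inj: "\<sigma> x = \<sigma> y \<longleftrightarrow> x = y" if "x \<in> gens A" "y \<in> gens A" for x y
    using bij that by (auto simp: bij_betw_def inj_on_def)
  have mem: "\<sigma> x \<in> gens B" if "x \<in> gens A" for x
    using bij that by (auto simp: bij_betw_def)
  define p where "p i j = (if i \<in> gens A \<and> j = \<sigma> i then idem (vert A i) else 0)" for i j
  define q where "q j i = p i j" for i j
  have val: "p i j \<in> {0, idem Circ, idem Bull, 1}" for i j
    by (cases "vert A i") (auto simp: p_def)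
  have p: "p \<in> idem_hom A B" and q: "q \<in> idem_hom B A"
    unfolding idem_hom_def using val
    by (auto simp: q_def p_def idem_idem vert mem intro!: tw_homI)
  have pq: "mcomp B p q = mident A"
  proof (intro ext)
    fix i k
    have "mcomp B p q i k = (\<Sum>j\<in>gens B. if j = \<sigma> i then mident A i k else 0)"
      unfolding mcomp_def
      by (intro sum.cong refl) (auto simp: p_def q_def mident_def idem_idem inj)
    also have "\<dots> = mident A i k"
      using mem B.finite_gens by (auto simp: mident_def)
    finally show "mcomp B p q i k = mident A i k" .
  qed
  have qp: "mcomp A q p = mident B"
  proof (intro ext)
    fix j l
    show "mcomp A q p j l = mident B j l"
    proof (cases "j \<in> gens B")
      case True
      then obtain i where i: "i \<in> gens A" "j = \<sigma> i" using bij by (auto simp: bij_betw_def)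
      have "mcomp A q p j l = (\<Sum>i'\<in>gens A. if i' = i then mident B j l else 0)"
        unfolding mcomp_def
        by (intro sum.cong refl)
          (auto simp: p_def q_def mident_def idem_idem inj mem vert i)
      then show ?thesis using i A.finite_gens by simp
    next
      case False
      then have "q j i * p i l = 0" for i by (auto simp: p_def q_def mem)
      then show ?thesis using False by (simp add: mcomp_def mident_def)
    qed
  qed
  have "mcomp A (tdiff A) p = mcomp B p (tdiff B)"
  proof (intro ext)
    fix i k
    \<comment> \<open>Injectivity on arrows lets the sum over the relabelled arrows be pulled back
      to \<open>E\<close>.\<close>
    have "inj_on (\<lambda>(x, u, y). (\<sigma> x, u, \<sigma> y)) E"
      by (auto simp: inj_on_def inj dest!: A.gens)
    then have "mcomp B p (tdiff B) i k
        = (\<Sum>(x, u, y)\<in>E. if \<sigma> y = k then p i (\<sigma> x) * basis u else 0)"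
      unfolding B.mcomp_tdiff by (subst sum.reindex) (auto intro!: sum.cong)
    also have "\<dots> = (\<Sum>(x, u, y)\<in>E. if x = i then basis u * p y k else 0)"
    proof (intro sum.cong refl, clarify)
      fix x u y assume e: "(x, u, y) \<in> E"
      have "idem (vert A x) * basis u = basis u" "basis u * idem (vert A y) = basis u"
        using A.vert[OF e] by (simp_all add: basis_mult word_mult_Idem_right)
      then show "(if \<sigma> y = k then p i (\<sigma> x) * basis u else 0) = (if x = i then basis u * p y k else 0)"
        using A.gens[OF e] by (auto simp: p_def inj)
    qed
    finally show "mcomp A (tdiff A) p i k = mcomp B p (tdiff B) i k"
      unfolding A.tdiff_mcomp by simp
  qed
  with p q pq qp show ?thesis
    unfolding strictly_isomorphic_def by blast
qed

section \<open>The four switches\<close>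

definition word_arrow :: "(nat \<Rightarrow> vertex) \<Rightarrow> arrow \<Rightarrow> nat \<times> word \<times> nat" where
  "word_arrow vt = (\<lambda>(a, X, k, b). (a, face_word (vt a) X k, b))"

text \<open>Distinctness matters: a repeated arrow cancels in the list sum but would count once in
  the set.\<close>

lemma arrow_matrix_eq_word_differential:
  assumes "distinct (map (word_arrow vt) as)"
  shows "arrow_matrix vt as = word_differential (set (map (word_arrow vt) as))"
proof (intro ext)
  fix i j
  have "arrow_matrix vt as i j
      = (\<Sum>(x, u, y)\<leftarrow>map (word_arrow vt) as. if x = i \<and> y = j then basis u else 0)"
    by (auto simp: arrow_matrix_def word_arrow_def intro!: arg_cong[of _ _ sum_list])
  also have "\<dots> = word_differential (set (map (word_arrow vt) as)) i j"
    unfolding word_differential_def by (rule sum_list_distinct_conv_sum_set[OF assms])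
  finally show "arrow_matrix vt as i j = word_differential (set (map (word_arrow vt) as)) i j" .
qed

text \<open>Common arrows are counted twice and cancel in characteristic two.\<close>

lemma madd_word_differential:
  assumes "finite E" "finite F"
  shows "madd (word_differential E) (word_differential F) = word_differential ((E - F) \<union> (F - E))"
proof -
  have split: "word_differential S = madd (word_differential (S - T)) (word_differential (S \<inter> T))"
    if "finite S" for S T :: "('a \<times> word \<times> 'a) set"
    unfolding madd_def word_differential_def using that
    by (subst (1) sum.Int_Diff[of S _ T]) (auto simp: add.commute)
  have "madd (word_differential E) (word_differential F)
      = madd (word_differential (E - F)) (word_differential (F - E))"
    using split[OF assms(1), of F] split[OF assms(2), of E] by (simp add: Int_commute madd_ac)
  also have "\<dots> = word_differential ((E - F) \<union> (F - E))"
    unfolding madd_def word_differential_def using assms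
    by (subst sum.union_disjoint) auto
  finally show ?thesis .
qed

text \<open>The symmetric differences written out: in each case two arrows of \<open>N\<close> give
  way to the two crossed ones, listed first.\<close>

fun arrows_N_with :: "switch \<Rightarrow> (nat \<times> word \<times> nat) set" where
"arrows_N_with S18 =
   {(22, RWord 0, 3), (4, RWord 0, 23), (17, RWord 0, 18), (16, MWord Circ 0, 17),
    (16, LWord 0, 15), (15, MWord Circ 0, 14), (14, RWord 0, 13), (13, MWord Bull 1, 10),
    (10, RWord 0, 9), (8, MWord Bull 1, 9), (7, RWord 0, 8), (6, MWord Circ 0, 7),
    (6, LWord 0, 5), (5, MWord Circ 0, 4), (2, MWord Circ 0, 3), (2, LWord 0, 1),
    (1, MWord Circ 0, 0), (0, RWord 0, 19), (20, MWord Circ 0, 19), (20, LWord 0, 21),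
    (21, MWord Circ 0, 22), (23, MWord Bull 1, 26), (26, RWord 0, 27), (30, MWord Bull 1, 27),
    (31, RWord 0, 30), (32, MWord Circ 0, 31), (32, LWord 0, 33), (33, MWord Circ 0, 34),
    (34, RWord 0, 35), (35, MWord Bull 1, 36)}"
| "arrows_N_with S25 =
   {(20, LWord 0, 5), (6, LWord 0, 21), (17, RWord 0, 18), (16, MWord Circ 0, 17),
    (16, LWord 0, 15), (15, MWord Circ 0, 14), (14, RWord 0, 13), (13, MWord Bull 1, 10),
    (10, RWord 0, 9), (8, MWord Bull 1, 9), (7, RWord 0, 8), (6, MWord Circ 0, 7),
    (5, MWord Circ 0, 4), (4, RWord 0, 3), (2, MWord Circ 0, 3), (2, LWord 0, 1),
    (1, MWord Circ 0, 0), (0, RWord 0, 19), (20, MWord Circ 0, 19), (21, MWord Circ 0, 22),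
    (22, RWord 0, 23), (23, MWord Bull 1, 26), (26, RWord 0, 27), (30, MWord Bull 1, 27),
    (31, RWord 0, 30), (32, MWord Circ 0, 31), (32, LWord 0, 33), (33, MWord Circ 0, 34),
    (34, RWord 0, 35), (35, MWord Bull 1, 36)}"
| "arrows_N_with S69 =
   {(0, RWord 0, 27), (26, RWord 0, 19), (17, RWord 0, 18), (16, MWord Circ 0, 17),
    (16, LWord 0, 15), (15, MWord Circ 0, 14), (14, RWord 0, 13), (13, MWord Bull 1, 10),
    (10, RWord 0, 9), (8, MWord Bull 1, 9), (7, RWord 0, 8), (6, MWord Circ 0, 7),
    (6, LWord 0, 5), (5, MWord Circ 0, 4), (4, RWord 0, 3), (2, MWord Circ 0, 3),
    (2, LWord 0, 1), (1, MWord Circ 0, 0), (20, MWord Circ 0, 19), (20, LWord 0, 21),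
    (21, MWord Circ 0, 22), (22, RWord 0, 23), (23, MWord Bull 1, 26), (30, MWord Bull 1, 27),
    (31, RWord 0, 30), (32, MWord Circ 0, 31), (32, LWord 0, 33), (33, MWord Circ 0, 34),
    (34, RWord 0, 35), (35, MWord Bull 1, 36)}"
| "arrows_N_with S74 =
   {(20, LWord 0, 33), (32, LWord 0, 21), (17, RWord 0, 18), (16, MWord Circ 0, 17),
    (16, LWord 0, 15), (15, MWord Circ 0, 14), (14, RWord 0, 13), (13, MWord Bull 1, 10),
    (10, RWord 0, 9), (8, MWord Bull 1, 9), (7, RWord 0, 8), (6, MWord Circ 0, 7),
    (6, LWord 0, 5), (5, MWord Circ 0, 4), (4, RWord 0, 3), (2, MWord Circ 0, 3),
    (2, LWord 0, 1), (1, MWord Circ 0, 0), (0, RWord 0, 19), (20, MWord Circ 0, 19),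
    (21, MWord Circ 0, 22), (22, RWord 0, 23), (23, MWord Bull 1, 26), (26, RWord 0, 27),
    (30, MWord Bull 1, 27), (31, RWord 0, 30), (32, MWord Circ 0, 31), (33, MWord Circ 0, 34),
    (34, RWord 0, 35), (35, MWord Bull 1, 36)}"

lemma tdiff_N_with: "tdiff (N_with s) = word_differential (arrows_N_with s)"
proof -
  have "distinct (map (word_arrow vert_N) arrows_N)" "distinct (map (word_arrow vert_N) (arrows_b s))"
    by (cases s; simp add: word_arrow_def arrows_N_def vert_N_def)+
  then have "tdiff (N_with s) = madd (word_differential (set (map (word_arrow vert_N) arrows_N)))
      (word_differential (set (map (word_arrow vert_N) (arrows_b s))))"
    by (simp add: N_with_def delta_N_def switch_matrix_def arrow_matrix_eq_word_differential)
  also have "\<dots> = word_differential (arrows_N_with s)"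
    unfolding madd_word_differential[OF finite_set finite_set]
    by (rule arg_cong[of _ _ word_differential], cases s)
      (simp_all add: word_arrow_def arrows_N_def vert_N_def insert_Diff_if)
  finally show ?thesis .
qed

text \<open>Uniqueness, \<open>in_M\<close> and the vanishing of the squared differential are all
  conditions on pairs of arrows, so one finite check settles them together.\<close>

definition compatible_arrows :: "nat \<times> word \<times> nat \<Rightarrow> nat \<times> word \<times> nat \<Rightarrow> bool" where
  "compatible_arrows = (\<lambda>(x, u, y) (x', v, y').
     (u = v \<longrightarrow> (x = x' \<longleftrightarrow> y = y')) \<and>
     (u = MWord Circ 0 \<and> v = MWord Bull 1 \<longrightarrow> y \<noteq> y') \<and>
     (y = x' \<longrightarrow> word_mult u v = None))"

lemma arrows_N_with_valid:
  "\<forall>(x, u, y)\<in>arrows_N_with s. x \<in> V_N \<and> y \<in> V_N \<and> src u = vert_N x \<and> tgt u = vert_N y \<and>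
    u \<in> short_words"
  by (cases s) (simp_all add: V_N_def vert_N_def short_words_def)

lemma arrows_N_with_compatible:
  assumes "e \<in> arrows_N_with s" "e' \<in> arrows_N_with s"
  shows "compatible_arrows e e'"
proof -
  have "\<forall>e\<in>arrows_N_with s. \<forall>e'\<in>arrows_N_with s. compatible_arrows e e'"
    by (cases s) (simp_all add: compatible_arrows_def)
  with assms show ?thesis by blast
qed

lemma finite_arrows_N_with: "finite (arrows_N_with s)"
  by (cases s) simp_all

lemma string_complex_N_with: "string_complex (N_with s) (arrows_N_with s)"
proof
  show "finite (gens (N_with s))" by (simp add: N_with_def V_N_def)
  show "finite (arrows_N_with s)" by (rule finite_arrows_N_with)
  show "tdiff (N_with s) = word_differential (arrows_N_with s)" by (rule tdiff_N_with)
  fix x u y assume e: "(x, u, y) \<in> arrows_N_with s"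
  have gens: "gens (N_with s) = V_N" and vert: "vert (N_with s) = vert_N"
    by (simp_all add: N_with_def)
  show "x \<in> gens (N_with s) \<and> y \<in> gens (N_with s)"
    "src u = vert (N_with s) x \<and> tgt u = vert (N_with s) y" "u \<in> short_words"
    unfolding gens vert using arrows_N_with_valid[of s] e by auto
  show "y = y'" if "(x, u, y') \<in> arrows_N_with s" for y'
    using arrows_N_with_compatible[OF e that] by (simp add: compatible_arrows_def)
  show "x = x'" if "(x', u, y) \<in> arrows_N_with s" for x'
    using arrows_N_with_compatible[OF e that] by (simp add: compatible_arrows_def)
next
  show "(x', MWord Bull 1, y) \<notin> arrows_N_with s" if "(x, MWord Circ 0, y) \<in> arrows_N_with s" for x x' y
    using arrows_N_with_compatible[OF that, of "(x', MWord Bull 1, y)"]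
    by (auto simp: compatible_arrows_def)
qed

lemma tw_object_N_with: "tw_object (N_with s)"
proof (rule string_complex.tw_object_string_complex[OF string_complex_N_with])
  fix x u y v z assume "(x, u, y) \<in> arrows_N_with s" "(y, v, z) \<in> arrows_N_with s"
  then show "word_mult u v = None"
    using arrows_N_with_compatible[of "(x, u, y)" s "(y, v, z)"] by (simp add: compatible_arrows_def)
qed

text \<open>Interchanging the \<open>M\<close> arrows from \<open>5\<close> to \<open>4\<close> and
  from \<open>21\<close> to \<open>22\<close> uncrosses the \<open>R\<close> arrows that follow and
  crosses the \<open>L\<close> arrows that precede.\<close>

lemma strictly_isomorphic_S18_S25: "strictly_isomorphic (N_with S18) (N_with S25)"
proof (rule strictly_isomorphic_relabel[OF string_complex_N_with])
  define \<sigma> :: "nat \<Rightarrow> nat" where "\<sigma> = id(4 := 22, 22 := 4, 5 := 21, 21 := 5)"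
  have "(\<lambda>(x, u, y). (\<sigma> x, u, \<sigma> y)) ` arrows_N_with S18 = arrows_N_with S25"
    by (rule equalityI; simp add: \<sigma>_def)
  then show "string_complex (N_with S25) ((\<lambda>(x, u, y). (\<sigma> x, u, \<sigma> y)) ` arrows_N_with S18)"
    using string_complex_N_with[of S25] by simp
  have "\<sigma> ` V_N = V_N" by (rule equalityI; simp add: \<sigma>_def V_N_def)
  moreover have "inj_on \<sigma> V_N" by (auto simp: inj_on_def \<sigma>_def)
  ultimately show "bij_betw \<sigma> (gens (N_with S18)) (gens (N_with S25))"
    by (simp add: N_with_def bij_betw_def)
  show "vert (N_with S25) (\<sigma> x) = vert (N_with S18) x" for x
    by (simp add: N_with_def \<sigma>_def vert_N_def)
qed

lemma N_with_simulation:
  assumes "homotopy_equivalent (N_with s) (N_with t)" "a \<in> V_N"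
  obtains P b where "arrow_simulation (arrows_N_with s) (arrows_N_with t) P" "P a b"
proof -
  have "a \<in> gens (N_with s)" using assms(2) by (simp add: N_with_def)
  with homotopy_equivalent_simulation[OF string_complex_N_with string_complex_N_with assms(1)]
  show thesis using that by blast
qed

section \<open>Walks that separate the classes\<close>

lemma not_equivalent_S69:
  assumes "s \<in> {S18, S74}" shows "\<not> homotopy_equivalent (N_with S69) (N_with s)"
proof
  let ?E = "arrows_N_with S69" and ?F = "arrows_N_with s"
  assume "homotopy_equivalent (N_with S69) (N_with s)"
  then obtain P b where P: "arrow_simulation ?E ?F P" and b: "P 0 b"
    by (rule N_with_simulation[where a = 0]) (simp_all add: V_N_def)
  have E: "(1, MWord Circ 0, 0) \<in> ?E" "(0, RWord 0, 27) \<in> ?E" "(30, MWord Bull 1, 27) \<in> ?E"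
    by simp_all
  note sim = arrow_simulationD[OF P]
  obtain a where a: "(a, MWord Circ 0, b) \<in> ?F"
    using sim(2)[OF b E(1)] by blast
  obtain c where c: "(b, RWord 0, c) \<in> ?F" "P 27 c"
    using sim(1)[OF b E(2)] by blast
  obtain d where d: "(d, MWord Bull 1, c) \<in> ?F"
    using sim(2)[OF c(2) E(3)] by blast
  \<comment> \<open>In both targets the only \<open>R\<close> arrows ending where an arrow
    \<open>MWord Bull 1\<close> ends are those from \<open>10\<close> to \<open>9\<close> and from
    \<open>26\<close> to \<open>27\<close>.\<close>
  have "b \<in> {10, 26}"
    using assms c(1) d by auto
  \<comment> \<open>Neither \<open>10\<close> nor \<open>26\<close> is entered by an arrow
    \<open>MWord Circ 0\<close>.\<close>
  with a assms show False by auto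
qed

lemma not_equivalent_S74: "\<not> homotopy_equivalent (N_with S74) (N_with S18)"
proof
  let ?E = "arrows_N_with S74" and ?F = "arrows_N_with S18"
  assume "homotopy_equivalent (N_with S74) (N_with S18)"
  then obtain P b where P: "arrow_simulation ?E ?F P" and b: "P 20 b"
    by (rule N_with_simulation[where a = 20]) (simp_all add: V_N_def)
  have E: "(20, LWord 0, 33) \<in> ?E" "(33, MWord Circ 0, 34) \<in> ?E" "(34, RWord 0, 35) \<in> ?E"
    "(35, MWord Bull 1, 36) \<in> ?E" "(20, MWord Circ 0, 19) \<in> ?E" "(0, RWord 0, 19) \<in> ?E"
    by simp_all
  note sim = arrow_simulationD[OF P]
  obtain c where c: "(b, LWord 0, c) \<in> ?F" "P 33 c"
    using sim(1)[OF b E(1)] by blast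
  obtain d where d: "(c, MWord Circ 0, d) \<in> ?F" "P 34 d"
    using sim(1)[OF c(2) E(2)] by blast
  obtain e where e: "(d, RWord 0, e) \<in> ?F" "P 35 e"
    using sim(1)[OF d(2) E(3)] by blast
  obtain z where z: "(e, MWord Bull 1, z) \<in> ?F"
    using sim(1)[OF e(2) E(4)] by blast
  obtain m where m: "(b, MWord Circ 0, m) \<in> ?F" "P 19 m"
    using sim(1)[OF b E(5)] by blast
  obtain n where n: "(n, RWord 0, m) \<in> ?F"
    using sim(2)[OF m(2) E(6)] by blast
  \<comment> \<open>In \<open>S18\<close> an \<open>M\<close> arrow and an \<open>R\<close> arrow
    meet head to head only at \<open>3\<close> and \<open>19\<close>.\<close>
  have "b \<in> {2, 20}" using m(1) n by auto
  then have "c \<in> {1, 21}" using c(1) by auto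
  then have "d \<in> {0, 22}" using d(1) by auto
  \<comment> \<open>The switch is felt here: the crossed arrow leads from \<open>22\<close> to
    \<open>3\<close>, whereas \<open>23\<close> would have allowed the walk to continue.\<close>
  then have "e \<in> {3, 19}" using e(1) by auto
  then show False using z by auto
qed

theorem corollary4p3:
  shows "(\<forall>s. tw_object (N_with s)) \<and>
    card (range (\<lambda>s. homotopy_class (N_with s))) = 3 \<and>
    strictly_isomorphic (N_with S18) (N_with S25) \<and>
    homotopy_class (N_with S18) = homotopy_class (N_with S25) \<and>
    homotopy_class (N_with S18) \<noteq> homotopy_class (N_with S69) \<and>
    homotopy_class (N_with S18) \<noteq> homotopy_class (N_with S74) \<and>
    homotopy_class (N_with S69) \<noteq> homotopy_class (N_with S74)"
proof -
  have eq: "homotopy_class (N_with S18) = homotopy_class (N_with S25)"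
    using tw_object_N_with strictly_isomorphic_S18_S25
    by (intro homotopy_class_eq strictly_isomorphic_imp_homotopy_equivalent)
      (auto simp: tw_object_def)
  \<comment> \<open>Equality of classes can be read in either order, so each pair needs only the
    direction of nonequivalence proved above.\<close>
  have neq: "homotopy_class (N_with S18) \<noteq> homotopy_class (N_with S69)"
    "homotopy_class (N_with S18) \<noteq> homotopy_class (N_with S74)"
    "homotopy_class (N_with S69) \<noteq> homotopy_class (N_with S74)"
    using not_equivalent_S69 not_equivalent_S74
      homotopy_class_eqD[OF tw_object_N_with] by (metis insertCI)+
  have UNIV: "UNIV = {S18, S25, S69, S74}" using switch.exhaust by blast
  have "range (\<lambda>s. homotopy_class (N_with s))
      = {homotopy_class (N_with S18), homotopy_class (N_with S69), homotopy_class (N_with S74)}"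
    by (simp add: UNIV eq)
  with neq have "card (range (\<lambda>s. homotopy_class (N_with s))) = 3"
    by simp
  with eq neq tw_object_N_with strictly_isomorphic_S18_S25 show ?thesis
    by blast
qed

end
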